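(* Let $q$ be a prime power and $n\geq 3$ an integer. Then the set of distance eigenvalues of the graph $S(q,n,1)$ is $$\left\{\frac{5q^n-2q^{n-1}-2q-1}{q-1},\ \frac{-q^n+2q^{n-1}-2q+1}{q-1},\ \frac{-2q^2-2\sqrt{q^{n+2}}}{q^2},\ \frac{-2q^2+2\sqrt{q^{n+2}}}{q^2}\right\}.$$ Hence, if $n$ is an even integer, then $S(q,n,1)$ is distance integral.
   Context: Let $\mathbb{F}_q$ be the finite field of order $q$ and $V(q,n)$ an $n$-dimensional vector space over $\mathbb{F}_q$. The graph $S(q,n,1)$ has as vertex set $V_1\cup V_{n-1}$, where $V_1$ and $V_{n-1}$ are the sets of subspaces of $V(q,n)$ of dimension $1$ and $n-1$ respectively, and two vertices are adjacent iff one is a subspace of the other. The distance matrix of a connected graph is the matrix indexed by vertices whose $(u,w)$ entry is the graph distance between $u$ and $w$; a distance eigenvalue is an eigenvalue of this matrix, and a graph is distance integral if all its distance eigenvalues are integers. *)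

theory Defs
  imports
    Complex_Main
    "HOL-Library.Cardinality"
    "Jordan_Normal_Form.Char_Poly"
    "Graph_Theory.Pair_Digraph"
    "Graph_Theory.Shortest_Path"
begin

text \<open>Undirected graphs are represented, as usual in \<open>Graph_Theory\<close>, by symmetric sets of arcs.
  Only proper inclusions give arcs, since the graph has no loops.\<close>

definition (in vector_space) S_graph :: "'b set pair_pre_digraph" where
  "S_graph =
    (let V = {U. subspace U \<and> dim U = 1} \<union> {U. subspace U \<and> dim U = dim (UNIV :: 'b set) - 1}
     in \<lparr>pverts = V, parcs = {(U, W). U \<in> V \<and> W \<in> V \<and> (U \<subset> W \<or> W \<subset> U)}\<rparr>)"

lemma (in vector_space) S_graph_wf: "wf_digraph (with_proj S_graph)"
  by unfold_locales (auto simp: S_graph_def Let_def)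

lemma (in vector_space) S_graph_symmetric: "sym (parcs S_graph)"
  by (auto simp: S_graph_def Let_def sym_def)

lemma (in vector_space) S_graph_loopfree: "(U, U) \<notin> parcs S_graph"
  by (simp add: S_graph_def Let_def)

definition graph_distance :: "'v pair_pre_digraph \<Rightarrow> 'v \<Rightarrow> 'v \<Rightarrow> ereal" where
  "graph_distance G u w = wf_digraph.\<mu> (with_proj G) (\<lambda>_. 1) u w"

text \<open>Matrices have index set \<open>{0..<m}\<close>, so the distance matrix is taken with respect to an
  enumeration \<open>vs\<close> of the vertices; its eigenvalues do not depend on the enumeration. The entries
  are finite distances when the graph is connected. They are viewed in the complex
  numbers so that no complex eigenvalue is excluded by definition.\<close>

definition distance_matrix :: "'v pair_pre_digraph \<Rightarrow> 'v list \<Rightarrow> complex mat" where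
  "distance_matrix G vs = mat (length vs) (length vs)
     (\<lambda>(i, j). complex_of_real (real_of_ereal (graph_distance G (vs ! i) (vs ! j))))"

definition distance_eigenvalues :: "'v pair_pre_digraph \<Rightarrow> complex set" where
  "distance_eigenvalues G =
    {k. \<exists>vs. distinct vs \<and> set vs = pverts G \<and> eigenvalue (distance_matrix G vs) k}"

definition distance_integral :: "'v pair_pre_digraph \<Rightarrow> bool" where
  "distance_integral G \<longleftrightarrow> distance_eigenvalues G \<subseteq> \<int>"

end

theory Submission
  imports Defs
begin

text \<open>Points and hyperplanes form a symmetric design: there are equally many of both, each is incident
  with \<open>k\<close> of the other kind, and two of the same kind have \<open>l\<close> common neighbours, where
  \<open>k - l = q ^ (n - 2)\<close>. Hence the incidence matrix \<open>B\<close> satisfies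
  \<open>B B\<^sup>T = B\<^sup>T B = q ^ (n - 2) I + l J\<close>. Distances are 2 within a class, and 1 or 3 between the classes,
  so the distance matrix has diagonal blocks \<open>2 (J - I)\<close> and off-diagonal blocks \<open>3 J - 2 B\<close>,
  \<open>3 J - 2 B\<^sup>T\<close>. Vectors constant on both classes give the first two eigenvalues. A vector that sums
  to zero on both classes satisfies \<open>(\<mu> + 2)\<^sup>2 = 4 q ^ (n - 2)\<close>.\<close>

section \<open>Symmetric designs\<close>

text \<open>The axioms are invariant under exchanging points and blocks, so facts are proved for
  points only and read for blocks through \<open>dual\<close>.\<close>

locale symmetric_design =
  fixes P :: "'p set" and H :: "'h set" and I :: "'p \<Rightarrow> 'h \<Rightarrow> bool" and N k l :: nat
  assumes finite_P: "finite P" and finite_H: "finite H"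
    and card_P: "card P = N" and card_H: "card H = N"
    and degree_P: "\<And>p. p \<in> P \<Longrightarrow> card {h \<in> H. I p h} = k"
    and degree_H: "\<And>h. h \<in> H \<Longrightarrow> card {p \<in> P. I p h} = k"
    and codegree_P: "\<And>p p'. p \<in> P \<Longrightarrow> p' \<in> P \<Longrightarrow> p \<noteq> p' \<Longrightarrow> card {h \<in> H. I p h \<and> I p' h} = l"
    and codegree_H: "\<And>h h'. h \<in> H \<Longrightarrow> h' \<in> H \<Longrightarrow> h \<noteq> h' \<Longrightarrow> card {p \<in> P. I p h \<and> I p h'} = l"
begin

lemma dual: "symmetric_design H P (\<lambda>h p. I p h) N k l"
  by unfold_locales
    (auto simp: finite_P finite_H card_P card_H degree_P degree_H codegree_P codegree_H)

text \<open>Double counting: each \<open>y h\<close> occurs once for each of the \<open>k\<close>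
  points on \<open>h\<close>.\<close>

lemma sum_incident:
  fixes y :: "'h \<Rightarrow> complex"
  shows "(\<Sum>p\<in>P. \<Sum>h | h \<in> H \<and> I p h. y h) = of_nat k * sum y H"
proof -
  have "(\<Sum>p\<in>P. \<Sum>h | h \<in> H \<and> I p h. y h) = (\<Sum>h\<in>H. \<Sum>p | p \<in> P \<and> I p h. y h)"
    by (rule sum.swap_restrict[OF finite_P finite_H])
  also have "\<dots> = (\<Sum>h\<in>H. of_nat k * y h)"
    by (intro sum.cong refl) (simp add: degree_H)
  finally show ?thesis by (simp add: sum_distrib_left)
qed

text \<open>This is \<open>B B\<^sup>T = (k - l) I + l J\<close> read entrywise: \<open>x p'\<close>
  is counted once per common block of \<open>p\<close> and \<open>p'\<close>, so \<open>k\<close>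
  times for \<open>p' = p\<close> and \<open>l\<close> times otherwise.\<close>

lemma sum_incident_twice:
  fixes x :: "'p \<Rightarrow> complex"
  assumes p: "p \<in> P"
  shows "(\<Sum>h | h \<in> H \<and> I p h. \<Sum>p' | p' \<in> P \<and> I p' h. x p')
    = (of_nat k - of_nat l) * x p + of_nat l * sum x P"
proof -
  have "(\<Sum>h | h \<in> H \<and> I p h. \<Sum>p' | p' \<in> P \<and> I p' h. x p')
    = (\<Sum>p'\<in>P. \<Sum>h | h \<in> {h \<in> H. I p h} \<and> I p' h. x p')"
    by (rule sum.swap_restrict) (use finite_P finite_H in auto)
  also have "\<dots> = (\<Sum>p'\<in>P. (if p' = p then (of_nat k - of_nat l) * x p' else 0) + of_nat l * x p')"
    using degree_P[OF p] codegree_P[OF p]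
    by (intro sum.cong refl) (auto simp: algebra_simps conj_assoc)
  also have "\<dots> = (of_nat k - of_nat l) * x p + of_nat l * sum x P"
    using p finite_P by (simp add: sum.distrib sum_distrib_left)
  finally show ?thesis .
qed

text \<open>The eigenvector equation at the points, when points are at distance 2 from each other, and
  a point is at distance 1 or 3 from a block, according to incidence.\<close>

definition point_equation :: "complex \<Rightarrow> ('p \<Rightarrow> complex) \<Rightarrow> ('h \<Rightarrow> complex) \<Rightarrow> bool" where
  "point_equation \<mu> x y \<longleftrightarrow>
    (\<forall>p\<in>P. 2 * (sum x P - x p) + (3 * sum y H - 2 * (\<Sum>h | h \<in> H \<and> I p h. y h)) = \<mu> * x p)"

text \<open>Summing over all points leaves only the two class totals. Together with its dual this is
  the eigenvector equation of a 2 by 2 quotient matrix.\<close>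

lemma point_equation_sum:
  assumes "point_equation \<mu> x y"
  shows "(2 * of_nat N - 2) * sum x P + (3 * of_nat N - 2 * of_nat k) * sum y H = \<mu> * sum x P"
proof -
  have "(\<Sum>p\<in>P. 2 * (sum x P - x p) + (3 * sum y H - 2 * (\<Sum>h | h \<in> H \<and> I p h. y h)))
    = (\<Sum>p\<in>P. \<mu> * x p)"
    using assms by (intro sum.cong refl) (simp add: point_equation_def)
  then show ?thesis
    by (simp add: sum.distrib sum_subtractf sum_incident card_P flip: sum_distrib_left)
      (simp add: algebra_simps)
qed

end

text \<open>When both totals vanish, the \<open>J\<close> terms drop out and the equations become
  \<open>(\<mu> + 2) x = -2 B y\<close> and \<open>(\<mu> + 2) y = -2 B\<^sup>T x\<close>.
  Substituting the second into the first leaves \<open>B B\<^sup>T\<close>, which acts on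
  \<open>x\<close> as \<open>k - l\<close>.\<close>

lemma (in symmetric_design) point_equation_square:
  assumes pt: "point_equation \<mu> x y"
    and bl: "symmetric_design.point_equation H P (\<lambda>h p. I p h) \<mu> y x"
    and sums: "sum x P = 0" "sum y H = 0" and p: "p \<in> P"
  shows "(\<mu> + 2)\<^sup>2 * x p = 4 * (of_nat k - of_nat l) * x p"
proof -
  interpret dual: symmetric_design H P "\<lambda>h p. I p h" N k l by (rule dual)
  have "2 * (0 - x p) + (3 * 0 - 2 * (\<Sum>h | h \<in> H \<and> I p h. y h)) = \<mu> * x p"
    using pt p unfolding point_equation_def sums by blast
  from this[symmetric] have x: "(\<mu> + 2) * x p = -2 * (\<Sum>h | h \<in> H \<and> I p h. y h)"
    unfolding distrib_right by simp
  have y: "(\<mu> + 2) * y h = -2 * (\<Sum>p | p \<in> P \<and> I p h. x p)" if "h \<in> H" for h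
  proof -
    have "2 * (0 - y h) + (3 * 0 - 2 * (\<Sum>p | p \<in> P \<and> I p h. x p)) = \<mu> * y h"
      using bl that unfolding dual.point_equation_def sums by blast
    from this[symmetric] show ?thesis unfolding distrib_right by simp
  qed
  have "(\<mu> + 2)\<^sup>2 * x p = -2 * (\<Sum>h | h \<in> H \<and> I p h. (\<mu> + 2) * y h)"
    using x by (simp add: power2_eq_square mult.assoc mult.left_commute flip: sum_distrib_left)
  also have "\<dots> = 4 * (\<Sum>h | h \<in> H \<and> I p h. \<Sum>p | p \<in> P \<and> I p h. x p)"
    by (simp add: y sum_distrib_left flip: sum_negf)
  finally show ?thesis
    using sum_incident_twice[OF p, of x] sums by simp
qed

text \<open>\<open>N \<ge> 2\<close> supplies a nonzero vector of total zero, and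
  \<open>l < k\<close> makes the root \<open>s\<close> nonzero, so that the witness may be divided
  by it.\<close>

theorem (in symmetric_design) distance_spectrum:
  assumes N: "N \<ge> 2" and kl: "l < k"
  shows "(\<exists>x y. ((\<exists>p\<in>P. x p \<noteq> 0) \<or> (\<exists>h\<in>H. y h \<noteq> 0)) \<and> point_equation \<mu> x y \<and>
      symmetric_design.point_equation H P (\<lambda>h p. I p h) \<mu> y x) \<longleftrightarrow>
    \<mu> \<in> complex_of_real ` {5 * real N - 2 * real k - 2, - real N + 2 * real k - 2,
      -2 - 2 * sqrt (real k - real l), -2 + 2 * sqrt (real k - real l)}"
    (is "?L \<longleftrightarrow> \<mu> \<in> ?S")
proof
  interpret dual: symmetric_design H P "\<lambda>h p. I p h" N k l by (rule dual)
  define s where "s = complex_of_real (sqrt (real k - real l))"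
  have s2: "s\<^sup>2 = of_nat k - of_nat l"
    unfolding s_def using kl by (simp flip: of_real_power)
  have s0: "s \<noteq> 0" using kl by (simp add: s_def)
  have S: "?S = {5 * of_nat N - 2 * of_nat k - 2, - of_nat N + 2 * of_nat k - 2, -2 - 2 * s, -2 + 2 * s}"
    by (simp add: s_def)
  {
    assume ?L
    then obtain x y where nz: "(\<exists>p\<in>P. x p \<noteq> 0) \<or> (\<exists>h\<in>H. y h \<noteq> 0)"
      and pt: "point_equation \<mu> x y" and bl: "dual.point_equation \<mu> y x" by blast
    show "\<mu> \<in> ?S"
    proof (cases "sum x P = 0 \<and> sum y H = 0")
      case True
      have "(\<mu> + 2)\<^sup>2 = 4 * (of_nat k - of_nat l)"
        using nz point_equation_square[OF pt bl] dual.point_equation_square[OF bl pt] True by auto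
      then have "(\<mu> + 2)\<^sup>2 = (2 * s)\<^sup>2" by (simp add: s2 power_mult_distrib)
      then have "\<mu> + 2 = 2 * s \<or> \<mu> + 2 = - (2 * s)" by (simp only: power2_eq_iff)
      then have "\<mu> = -2 + 2 * s \<or> \<mu> = -2 - 2 * s"
        by (metis add_diff_cancel_right' diff_minus_eq_add minus_diff_commute uminus_add_conv_diff)
      then show ?thesis unfolding S by blast
    next
      case False
      \<comment> \<open>Up to scale, \<open>u\<close> and \<open>v\<close> are the coordinates along
        the eigenvectors (1, 1) and (1, -1) of the quotient matrix, whose eigenvalues are
        \<open>(2 N - 2) + (3 N - 2 k)\<close> and \<open>(2 N - 2) - (3 N - 2 k)\<close>.\<close>
      define u v where "u = sum x P + sum y H" and "v = sum x P - sum y H"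
      have "\<mu> * u = (5 * of_nat N - 2 * of_nat k - 2) * u"
        "\<mu> * v = (- of_nat N + 2 * of_nat k - 2) * v"
        unfolding u_def v_def distrib_left[of \<mu>] right_diff_distrib[of \<mu>]
          point_equation_sum[OF pt, symmetric] dual.point_equation_sum[OF bl, symmetric]
        by (simp_all add: algebra_simps)
      moreover have "u \<noteq> 0 \<or> v \<noteq> 0"
        using False by (auto simp: u_def v_def)
      ultimately show ?thesis unfolding S by auto
    qed
  }
  {
    have "\<exists>p\<in>P. \<exists>p'\<in>P. p \<noteq> p'"
      using N card_P card_le_Suc0_iff_eq[OF finite_P] by auto
    then obtain p0 p1 where p01: "p0 \<in> P" "p1 \<in> P" "p0 \<noteq> p1" by blast
    \<comment> \<open>The difference of two point indicators is a nonzero vector with total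
      zero.\<close>
    define x where "x p = (if p = p0 then 1 else 0) - (if p = p1 then 1 else 0 :: complex)" for p
    have sx: "sum x P = 0" using p01 finite_P by (simp add: x_def sum_subtractf)
    define y where "y c h = c * (\<Sum>p | p \<in> P \<and> I p h. x p)" for c h
    have sy: "sum (y c) H = 0" for c
      using dual.sum_incident[of x] sx by (simp add: y_def flip: sum_distrib_left)
    have By: "(\<Sum>h | h \<in> H \<and> I p h. y c h) = c * s\<^sup>2 * x p" if "p \<in> P" for p c
      using sum_incident_twice[OF that, of x] by (simp add: y_def sx s2 flip: sum_distrib_left)
    \<comment> \<open>With \<open>\<mu> + 2 = 2 t\<close>, the block equation
      \<open>(\<mu> + 2) y = -2 B\<^sup>T x\<close> forces the factor \<open>c = - 1 / t\<close>;
      the point equation then holds because \<open>t\<^sup>2 = s\<^sup>2\<close>.\<close>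
    have main: ?L if "\<mu> = -2 + 2 * t" "t = s \<or> t = - s" for t
    proof (intro exI conjI)
      have t: "t\<^sup>2 = s\<^sup>2" "t \<noteq> 0" using that s0 by auto
      show "(\<exists>p\<in>P. x p \<noteq> 0) \<or> (\<exists>h\<in>H. y (- 1 / t) h \<noteq> 0)"
        using p01 by (auto simp: x_def)
      show "point_equation \<mu> x (y (- 1 / t))"
        unfolding point_equation_def
      proof
        fix p assume p: "p \<in> P"
        have "- 1 / t * s\<^sup>2 = - t" unfolding t(1)[symmetric] using t(2) by (simp add: power2_eq_square)
        then show "2 * (sum x P - x p) + (3 * sum (y (- 1 / t)) H -
            2 * (\<Sum>h | h \<in> H \<and> I p h. y (- 1 / t) h)) = \<mu> * x p"
          unfolding By[OF p] sx sy that(1) by (simp add: algebra_simps)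
      qed
      show "dual.point_equation \<mu> (y (- 1 / t)) x"
        unfolding dual.point_equation_def
      proof
        fix h assume "h \<in> H"
        define z where "z = (\<Sum>p | p \<in> P \<and> I p h. x p)"
        have y: "y (- 1 / t) h = - z / t" by (simp add: y_def z_def)
        show "2 * (sum (y (- 1 / t)) H - y (- 1 / t) h) +
            (3 * sum x P - 2 * (\<Sum>p | p \<in> P \<and> I p h. x p)) = \<mu> * y (- 1 / t) h"
          unfolding y sx sy that(1) z_def[symmetric] using t(2) by (simp add: field_simps)
      qed
    qed
    \<comment> \<open>The vector is 1 on points and \<open>e\<close> on blocks;
      \<open>e * e = 1\<close> makes both equations give the same \<open>\<mu>\<close>.\<close>
    have const: ?L if "\<mu> = (2 * of_nat N - 2) + e * (3 * of_nat N - 2 * of_nat k)" "e = 1 \<or> e = -1" for e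
    proof (intro exI conjI)
      show "(\<exists>p\<in>P. (\<lambda>_. 1 :: complex) p \<noteq> 0) \<or> (\<exists>h\<in>H. (\<lambda>_. e) h \<noteq> 0)"
        using p01 by auto
      show "point_equation \<mu> (\<lambda>_. 1) (\<lambda>_. e)"
        by (auto simp: point_equation_def card_P card_H degree_P that(1) algebra_simps)
      show "dual.point_equation \<mu> (\<lambda>_. e) (\<lambda>_. 1)"
        using that(2)
        by (auto simp: dual.point_equation_def card_P card_H degree_H that(1) algebra_simps)
    qed
    assume "\<mu> \<in> ?S"
    then consider "\<mu> = 5 * of_nat N - 2 * of_nat k - 2" | "\<mu> = - of_nat N + 2 * of_nat k - 2"
      | "\<mu> = -2 + 2 * (- s)" | "\<mu> = -2 + 2 * s" unfolding S by auto
    then show ?L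
      by cases (rule const[of 1] const[of "-1"] main[of "-s"] main[of s]; simp)+
  }
qed

section \<open>Eigenvectors as functions on the vertices\<close>

lemma distance_eigenvalues_iff:
  assumes "finite (pverts G)"
  shows "\<mu> \<in> distance_eigenvalues G \<longleftrightarrow>
    (\<exists>f. (\<exists>u\<in>pverts G. f u \<noteq> 0) \<and>
      (\<forall>u\<in>pverts G. (\<Sum>w\<in>pverts G. of_real (real_of_ereal (graph_distance G u w)) * f w) = \<mu> * f u))"
    (is "_ \<longleftrightarrow> ?R")
proof -
  let ?d = "\<lambda>u w. complex_of_real (real_of_ereal (graph_distance G u w))"
  \<comment> \<open>Reading a row through the enumeration removes \<open>vs\<close> from the
    eigenvector equation; both directions rely on it.\<close>
  have row: "(distance_matrix G vs *\<^sub>v v) $ i = (\<Sum>w\<in>pverts G. ?d (vs ! i) w * f w)"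
    if vs: "distinct vs" "set vs = pverts G" and v: "v \<in> carrier_vec (length vs)" and i: "i < length vs"
      and f: "\<And>j. j < length vs \<Longrightarrow> f (vs ! j) = v $ j" for vs v i f
  proof -
    have "(\<Sum>w\<in>pverts G. ?d (vs ! i) w * f w) = (\<Sum>j<length vs. ?d (vs ! i) (vs ! j) * v $ j)"
      using vs f
      by (intro sum.reindex_bij_betw[OF bij_betw_nth[OF vs(1) refl vs(2)[symmetric]], symmetric,
            THEN trans]) (auto intro!: sum.cong)
    then show ?thesis
      using v i by (simp add: distance_matrix_def scalar_prod_def atLeast0LessThan)
  qed
  show ?thesis
  proof
    assume "\<mu> \<in> distance_eigenvalues G"
    then obtain vs v where vs: "distinct vs" "set vs = pverts G"
      and v: "v \<in> carrier_vec (length vs)" "v \<noteq> 0\<^sub>v (length vs)"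
      and ev: "distance_matrix G vs *\<^sub>v v = \<mu> \<cdot>\<^sub>v v"
      by (auto simp: distance_eigenvalues_def eigenvalue_def eigenvector_def distance_matrix_def)
    \<comment> \<open>\<open>THE\<close> inverts the enumeration, which is injective as
      \<open>vs\<close> is distinct. Elsewhere the value is unspecified, but \<open>f\<close> is
      evaluated at vertices only.\<close>
    define f where "f u = v $ (THE j. j < length vs \<and> vs ! j = u)" for u
    have f: "f (vs ! j) = v $ j" if "j < length vs" for j
    proof -
      have "(THE i. i < length vs \<and> vs ! i = vs ! j) = j"
        using that vs by (intro the_equality) (auto simp: nth_eq_iff_index_eq)
      then show ?thesis by (simp add: f_def)
    qed
    obtain i where "i < length vs" "v $ i \<noteq> 0"
      using v by (metis carrier_vecD eq_vecI index_zero_vec)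
    then have "\<exists>u\<in>pverts G. f u \<noteq> 0"
      using f vs by (metis nth_mem)
    moreover have "(\<Sum>w\<in>pverts G. ?d u w * f w) = \<mu> * f u" if u: "u \<in> pverts G" for u
    proof -
      obtain i where i: "i < length vs" "vs ! i = u"
        using u by (auto simp: in_set_conv_nth simp flip: vs(2))
      then show ?thesis
        using row[OF vs v(1) i(1), of f] ev v(1) f by auto
    qed
    ultimately show ?R by blast
  next
    assume ?R
    then obtain f u where u: "u \<in> pverts G" "f u \<noteq> 0"
      and ev: "\<And>u. u \<in> pverts G \<Longrightarrow> (\<Sum>w\<in>pverts G. ?d u w * f w) = \<mu> * f u" by blast
    obtain vs where vs: "distinct vs" "set vs = pverts G"
      using finite_distinct_list[OF assms] by blast
    define v where "v = vec (length vs) (\<lambda>j. f (vs ! j))"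
    have v: "v \<in> carrier_vec (length vs)" by (simp add: v_def)
    obtain i where "i < length vs" "vs ! i = u"
      using u(1) by (auto simp: in_set_conv_nth simp flip: vs(2))
    then have "v $ i \<noteq> 0\<^sub>v (length vs) $ i" using u by (simp add: v_def)
    then have "v \<noteq> 0\<^sub>v (length vs)" by auto
    moreover have "distance_matrix G vs *\<^sub>v v = \<mu> \<cdot>\<^sub>v v"
    proof (rule eq_vecI)
      fix i assume "i < dim_vec (\<mu> \<cdot>\<^sub>v v)"
      then have i: "i < length vs" by (simp add: v_def)
      show "(distance_matrix G vs *\<^sub>v v) $ i = (\<mu> \<cdot>\<^sub>v v) $ i"
        using row[OF vs v i, of f] ev[of "vs ! i"] i nth_mem[OF i] vs(2) by (simp add: v_def)
    qed (simp add: distance_matrix_def v_def)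
    ultimately show "\<mu> \<in> distance_eigenvalues G"
      using vs v
      by (auto simp: distance_eigenvalues_def eigenvalue_def eigenvector_def distance_matrix_def)
  qed
qed

section \<open>Distances as lengths of shortest walks\<close>

lemma awalk_length_ge_2:
  assumes "pre_digraph.awalk (with_proj G) u p v" "u \<noteq> v" "(u, v) \<notin> parcs G"
    and G: "wf_digraph (with_proj G)"
  shows "2 \<le> length p"
proof -
  interpret wf_digraph "with_proj G" by (rule G)
  show ?thesis
    using assms by (cases p; cases "tl p") (auto simp: awalk_simps)
qed

text \<open>No arc would give \<open>u = v\<close>, a single arc would join \<open>u\<close> to
  \<open>v\<close>, and two arcs would pass through an excluded \<open>w\<close>.\<close>

lemma awalk_length_ge_3:
  assumes "pre_digraph.awalk (with_proj G) u p v" "u \<noteq> v" "(u, v) \<notin> parcs G"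
    and "\<And>w. (u, w) \<in> parcs G \<Longrightarrow> (w, v) \<notin> parcs G"
    and G: "wf_digraph (with_proj G)"
  shows "3 \<le> length p"
proof -
  interpret wf_digraph "with_proj G" by (rule G)
  show ?thesis
    using assms by (cases p; cases "tl p"; cases "tl (tl p)") (auto simp: awalk_simps)
qed

text \<open>The distance is an infimum over walks, and unit arc costs turn cost into length, so one
  walk and a matching lower bound determine it.\<close>

lemma graph_distance_eqI:
  assumes G: "wf_digraph (with_proj G)"
    and p: "pre_digraph.awalk (with_proj G) u p v" "length p = m"
    and min: "\<And>p. pre_digraph.awalk (with_proj G) u p v \<Longrightarrow> m \<le> length p"
  shows "graph_distance G u v = ereal (real m)"
proof -
  interpret wf_digraph "with_proj G" by (rule G)
  have cost: "awalk_cost (\<lambda>_. 1) p = real (length p)" for p :: "('a \<times> 'a) list"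
    by (induction p) auto
  show ?thesis
    unfolding graph_distance_def \<mu>_def cost
  proof (rule antisym)
    show "(INF p\<in>{p. awalk u p v}. ereal (real (length p))) \<le> ereal (real m)"
      using p by (auto intro!: INF_lower2)
    show "ereal (real m) \<le> (INF p\<in>{p. awalk u p v}. ereal (real (length p)))"
      using min by (auto intro!: INF_greatest)
  qed
qed

section \<open>Counting points and hyperplanes\<close>

text \<open>For \<open>q \<ge> 2\<close> this is \<open>(q ^ m - 1) / (q - 1)\<close>, the number of
  points of an \<open>m\<close>-dimensional space over a field of order \<open>q\<close>. The sum
  needs no division, and its consecutive values differ by a power of \<open>q\<close>.\<close>

definition gaussian :: "nat \<Rightarrow> nat \<Rightarrow> nat" where
  "gaussian q m = (\<Sum>i<m. q ^ i)"

lemma gaussian: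
  assumes "q \<ge> 2"
  shows "(q - 1) * gaussian q m + 1 = q ^ m"
proof (induction m)
  case (Suc m)
  then show ?case using assms by (cases q) (auto simp: gaussian_def algebra_simps)
qed (simp add: gaussian_def)

text \<open>The counts of points and hyperplanes below all arise in the form
  \<open>(q - 1) * c + 1 = q ^ m\<close>, free of truncated subtraction from the power.\<close>

lemma gaussian_eqI:
  assumes "q \<ge> 2" and "(q - 1) * c + 1 = q ^ m"
  shows "c = gaussian q m"
proof -
  have "(q - 1) * c = (q - 1) * gaussian q m" using gaussian[OF assms(1), of m] assms(2) by linarith
  then show ?thesis using assms(1) by simp
qed

locale finite_field_space = finite_dimensional_vector_space scale Basis
  for scale :: "'a::{field,finite} \<Rightarrow> 'b::ab_group_add \<Rightarrow> 'b" and Basis :: "'b set"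
begin

abbreviation points :: "'b set set" where "points \<equiv> {U. subspace U \<and> dim U = 1}"

abbreviation hyperplanes :: "'b set set" where
  "hyperplanes \<equiv> {U. subspace U \<and> dim U = dimension - 1}"

lemma CARD_ge_2: "CARD('a) \<ge> 2"
proof -
  have "card {0, 1 :: 'a} \<le> CARD('a)" by (intro card_mono) auto
  then show ?thesis by simp
qed

text \<open>The map \<open>?f\<close> is a bijection from pairs of a scalar and a vector of
  \<open>W\<close>: if pairs with different scalars had the same image, \<open>v\<close> would lie
  in \<open>W\<close>.\<close>

lemma card_span_insert:
  assumes W: "subspace W" and v: "v \<notin> W"
  shows "card (span (insert v W)) = CARD('a) * card W"
proof -
  let ?f = "\<lambda>(c, w). scale c v + w"
  have "inj_on ?f (UNIV \<times> W)"
  proof (rule inj_onI, clarsimp)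
    fix c d w w' assume w: "w \<in> W" "w' \<in> W" and eq: "scale c v + w = scale d v + w'"
    then have *: "scale (c - d) v = w' - w"
      by (simp add: scale_left_diff_distrib algebra_simps)
    have "c = d"
    proof (rule ccontr)
      assume "c \<noteq> d"
      then have "v = scale (1 / (c - d)) (w' - w)" by (simp flip: *)
      then show False using v w W by (metis subspace_diff subspace_scale)
    qed
    then show "c = d \<and> w = w'" using eq by simp
  qed
  moreover have "?f ` (UNIV \<times> W) = span (insert v W)"
  proof (intro Set.set_eqI iffI)
    fix x assume "x \<in> span (insert v W)"
    then obtain c where "x - scale c v \<in> W"
      using W by (auto simp: span_breakdown_eq span_eq_iff[THEN iffD2])
    then have "x = ?f (c, x - scale c v)" "(c, x - scale c v) \<in> UNIV \<times> W" by auto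
    then show "x \<in> ?f ` (UNIV \<times> W)" by (rule image_eqI)
  qed (auto intro!: span_add span_scale intro: span_base)
  ultimately show ?thesis
    by (metis card_image card_cartesian_product)
qed

lemma card_subspace:
  assumes "subspace U"
  shows "card U = CARD('a) ^ dim U"
proof -
  obtain B where B: "B \<subseteq> U" "independent B" "U \<subseteq> span B" "card B = dim U"
    by (rule basis_exists)
  have "card (span B) = CARD('a) ^ card B" if "finite B" "independent B" for B
    using that
  proof (induction B)
    case (insert v B)
    then have "v \<notin> span B" "independent B"
      by (auto simp: independent_insert)
    then have "card (span (insert v (span B))) = CARD('a) * card (span B)"
      by (intro card_span_insert) auto
    moreover have "span (insert v (span B)) = span (insert v B)"
      by (simp add: set_eq_iff span_breakdown_eq span_span)
    ultimately show ?case using insert \<open>independent B\<close> by simp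
  qed simp
  then show ?thesis
    using B assms finiteI_independent[of B] span_minimal[of B U] by (metis subset_antisym)
qed

lemma card_space: "card (UNIV :: 'b set) = CARD('a) ^ dimension"
  using card_subspace[OF subspace_UNIV] by (simp add: dimension_def)

lemma finite_space: "finite (S :: 'b set)"
proof -
  \<comment> \<open>The formula \<open>card_space\<close> was obtained without finiteness of the
    space, and \<open>card\<close> is 0 on infinite sets, so a nonzero value proves
    finiteness.\<close>
  have "card (UNIV :: 'b set) \<noteq> 0" using CARD_ge_2 by (simp add: card_space)
  then have "finite (UNIV :: 'b set)" by (metis card.infinite)
  then show ?thesis by (rule finite_subset[OF subset_UNIV])
qed

lemma finite_family: "finite (S :: 'b set set)"
  by (rule finite_subset[OF subset_UNIV]) (simp add: finite_space Finite_Set.finite_set)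

lemma point_eq_span:
  assumes "p \<in> points" "v \<in> p" "v \<noteq> 0"
  shows "p = span {v}"
  using assms subspace_dim_equal[of "span {v}" p] span_minimal[of "{v}" p] by simp

text \<open>The nonzero vectors of \<open>U\<close> are partitioned by the points inside
  \<open>U\<close>, each holding \<open>CARD('a) - 1\<close> of them; the added 1 is the zero
  vector.\<close>

lemma card_points_subset:
  assumes U: "subspace U"
  shows "(CARD('a) - 1) * card {p \<in> points. p \<subseteq> U} + 1 = card U"
proof -
  let ?P = "{p \<in> points. p \<subseteq> U}"
  have "U - {0} = (\<Union>p\<in>?P. p - {0})"
  proof (intro Set.set_eqI iffI)
    fix v assume "v \<in> U - {0}"
    then have "span {v} \<in> ?P" "v \<in> span {v} - {0}"
      using U span_minimal[of "{v}" U] by (auto intro: span_base)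
    then show "v \<in> (\<Union>p\<in>?P. p - {0})" by (rule UN_I)
  qed auto
  moreover have "card (\<Union>p\<in>?P. p - {0}) = (\<Sum>p\<in>?P. card (p - {0}))"
  proof (rule card_UN_disjoint)
    show "\<forall>p\<in>?P. \<forall>p'\<in>?P. p \<noteq> p' \<longrightarrow> (p - {0}) \<inter> (p' - {0}) = {}"
      using point_eq_span by blast
  qed (auto simp: finite_family finite_space)
  moreover have "card (p - {0}) = CARD('a) - 1" if "p \<in> ?P" for p
    using that card_subspace[of p] subspace_0[of p] by simp
  moreover have "card U = card (U - {0}) + 1"
    using subspace_0[OF U] card_Suc_Diff1[OF finite_space, of 0 U] by simp
  ultimately show ?thesis by simp
qed

text \<open>Double counting the pairs of a vector outside \<open>W\<close> and a hyperplane containing both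
  expresses the number of hyperplanes above \<open>W\<close> by the number above a subspace of one dimension more.\<close>

lemma card_hyperplanes_superset:
  assumes "subspace W" "dim W < dimension"
  shows "(CARD('a) - 1) * card {h \<in> hyperplanes. W \<subseteq> h} + 1 = CARD('a) ^ (dimension - dim W)"
  using assms
\<comment> \<open>The induction climbs from \<open>W\<close> towards larger subspaces; in the base
  case \<open>W\<close> is itself a hyperplane.\<close>
proof (induction "dimension - 1 - dim W" arbitrary: W)
  case 0
  then have d: "dim W = dimension - 1" by simp
  have "h = W" if "h \<in> hyperplanes" "W \<subseteq> h" for h
    using that 0 d subspace_dim_equal[of W h] by simp
  then have "{h \<in> hyperplanes. W \<subseteq> h} = {W}"
    using 0 d by blast
  moreover have "dimension - dim W = 1" using 0 d by simp
  ultimately show ?case using CARD_ge_2 by simp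
next
  case (Suc e W)
  let ?H = "{h \<in> hyperplanes. W \<subseteq> h}"
  define d where "d = dim W"
  have n: "dimension = d + e + 2" using Suc by (simp add: d_def)
  have above: "(CARD('a) - 1) * card {h \<in> ?H. v \<in> h} + 1 = CARD('a) ^ (e + 1)" if v: "v \<in> - W" for v
  proof -
    let ?W = "span (insert v W)"
    have W: "dim ?W = d + 1"
      using v Suc.prems by (simp add: dim_insert d_def span_eq_iff[THEN iffD2])
    then have "(CARD('a) - 1) * card {h \<in> hyperplanes. ?W \<subseteq> h} + 1 = CARD('a) ^ (dimension - dim ?W)"
      by (intro Suc) (simp_all add: n)
    moreover have "{h \<in> ?H. v \<in> h} = {h \<in> hyperplanes. ?W \<subseteq> h}"
      using span_minimal[of "insert v W"] span_superset[of "insert v W"] by auto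
    ultimately show ?thesis using W n by simp
  qed
  \<comment> \<open>A hyperplane has \<open>CARD('a) ^ (dimension - 1)\<close> vectors, where
    \<open>dimension - 1 = d + e + 1\<close>; the \<open>CARD('a) ^ d\<close> vectors of
    \<open>W\<close> are discarded.\<close>
  have "(\<Sum>v\<in>-W. card {h \<in> ?H. v \<in> h}) = (CARD('a) ^ (d + e + 1) - CARD('a) ^ d) * card ?H"
  proof (rule sum_multicount[OF finite_space finite_family], rule ballI)
    fix h assume h: "h \<in> ?H"
    have "{v \<in> - W. v \<in> h} = h - W" by auto
    then show "card {v \<in> - W. v \<in> h} = CARD('a) ^ (d + e + 1) - CARD('a) ^ d"
      using h Suc.prems card_subspace[of h] card_subspace[of W] n
      by (simp add: card_Diff_subset finite_space d_def)
  qed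
  then have "(CARD('a) - 1) * ((CARD('a) ^ (d + e + 1) - CARD('a) ^ d) * card ?H)
    = (\<Sum>v\<in>-W. (CARD('a) - 1) * card {h \<in> ?H. v \<in> h})"
    by (simp only: sum_distrib_left[symmetric])
  also have "\<dots> = (\<Sum>v\<in>-W. CARD('a) ^ (e + 1) - 1)"
    by (intro sum.cong refl, drule above) linarith
  also have "\<dots> = (CARD('a) ^ (d + e + 2) - CARD('a) ^ d) * (CARD('a) ^ (e + 1) - 1)"
    using card_subspace[OF Suc.prems(1)] n
    by (simp add: Compl_eq_Diff_UNIV card_Diff_subset finite_space card_space d_def)
  finally have "(CARD('a) - 1) * ((CARD('a) ^ (d + e + 1) - CARD('a) ^ d) * card ?H)
    = (CARD('a) ^ (d + e + 2) - CARD('a) ^ d) * (CARD('a) ^ (e + 1) - 1)" .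
  \<comment> \<open>Both sides share the factor
    \<open>CARD('a) ^ d * (CARD('a) ^ (e + 1) - 1)\<close>, nonzero because
    \<open>e + 1 > 0\<close>; cancelling it leaves the claim.\<close>
  moreover have "CARD('a) ^ (d + e + 1) - CARD('a) ^ d = CARD('a) ^ d * (CARD('a) ^ (e + 1) - 1)"
    "CARD('a) ^ (d + e + 2) - CARD('a) ^ d = CARD('a) ^ d * (CARD('a) ^ (e + 2) - 1)"
    by (simp_all add: power_add diff_mult_distrib2 mult_ac)
  ultimately have "(CARD('a) ^ d * (CARD('a) ^ (e + 1) - 1)) * ((CARD('a) - 1) * card ?H)
    = (CARD('a) ^ d * (CARD('a) ^ (e + 1) - 1)) * (CARD('a) ^ (e + 2) - 1)"
    by (simp only: mult_ac)
  moreover have "CARD('a) ^ d * (CARD('a) ^ (e + 1) - 1) \<noteq> 0"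
    using CARD_ge_2 one_less_power[of "CARD('a)" "e + 1"] by simp
  ultimately have "(CARD('a) - 1) * card ?H = CARD('a) ^ (e + 2) - 1"
    by (simp only: mult_cancel_left) simp
  moreover have "1 \<le> CARD('a) ^ (e + 2)" using CARD_ge_2 by simp
  ultimately show ?case using n by (simp add: d_def)
qed

text \<open>A vector \<open>v\<close> of \<open>h'\<close> outside \<open>h\<close> spans the whole
  space together with \<open>h\<close>, hence spans \<open>h'\<close> together with
  \<open>h \<inter> h'\<close>. So \<open>h'\<close> is larger than the intersection by the factor
  \<open>CARD('a)\<close>.\<close>

lemma card_hyperplanes_Int:
  assumes h: "h \<in> hyperplanes" "h' \<in> hyperplanes" "h \<noteq> h'" and n: "dimension \<ge> 2"
  shows "card (h \<inter> h') = CARD('a) ^ (dimension - 2)"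
proof -
  have "\<not> h' \<subseteq> h" using h subspace_dim_equal[of h' h] by auto
  then obtain v where v: "v \<in> h'" "v \<notin> h" by blast
  have "dim (insert v h) = dimension"
    using h v n by (simp add: dim_insert span_eq_iff[THEN iffD2])
  then have full: "span (insert v h) = UNIV" using dim_eq_full by blast
  have sub: "subspace (h \<inter> h')" using h by (auto intro: subspace_inter)
  have "h' = span (insert v (h \<inter> h'))"
  proof
    show "span (insert v (h \<inter> h')) \<subseteq> h'" using v h by (intro span_minimal) auto
    show "h' \<subseteq> span (insert v (h \<inter> h'))"
    proof
      fix x assume x: "x \<in> h'"
      obtain c where "x - scale c v \<in> h"
        using full h span_breakdown_eq[of x v h] by (auto simp: span_eq_iff[THEN iffD2])
      moreover have "x - scale c v \<in> h'"
        using x v h by (auto intro: subspace_diff subspace_scale)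
      ultimately have "x - scale c v \<in> span (h \<inter> h')" by (auto intro: span_base)
      then show "x \<in> span (insert v (h \<inter> h'))" by (auto simp: span_breakdown_eq)
    qed
  qed
  then have "card h' = CARD('a) * card (h \<inter> h')"
    using card_span_insert[OF sub, of v] v by simp
  moreover have "card h' = CARD('a) * CARD('a) ^ (dimension - 2)"
    using h n card_subspace[of h'] by (simp flip: power_Suc add: Suc_diff_Suc numeral_2_eq_2)
  ultimately show ?thesis using CARD_ge_2 by simp
qed

end

section \<open>Points and hyperplanes as a symmetric design\<close>

locale projective_space = finite_field_space scale Basis
  for scale :: "'a::{field,finite} \<Rightarrow> 'b::ab_group_add \<Rightarrow> 'b" and Basis :: "'b set" +
  assumes dimension_ge_3: "dimension \<ge> 3"
begin

text \<open>Distinct points span a two-dimensional subspace, and a hyperplane contains both iff it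
  contains that span, so \<open>card_hyperplanes_superset\<close> applies.\<close>

lemma hyperplanes_above_two_points:
  assumes "p \<in> points" "p' \<in> points" "p \<noteq> p'"
  shows "card {h \<in> hyperplanes. p \<subseteq> h \<and> p' \<subseteq> h} = gaussian CARD('a) (dimension - 2)"
proof -
  have "\<not> p' \<subseteq> p" using assms subspace_dim_equal[of p' p] by auto
  then obtain v where v: "v \<in> p'" "v \<notin> p" by blast
  then have p': "p' = span {v}"
    using assms subspace_0[of p] by (intro point_eq_span) auto
  have d: "dim (span (insert v p)) = 2"
    using v assms by (simp add: dim_insert span_eq_iff[THEN iffD2])
  have "span (insert v p) \<subseteq> h \<longleftrightarrow> p \<subseteq> h \<and> p' \<subseteq> h" if "h \<in> hyperplanes" for h
    using that span_minimal[of "insert v p" h] span_minimal[of "{v}" h]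
      span_superset[of "insert v p"] span_superset[of "{v}"] p' by auto
  then have "{h \<in> hyperplanes. p \<subseteq> h \<and> p' \<subseteq> h} = {h \<in> hyperplanes. span (insert v p) \<subseteq> h}"
    by blast
  then show ?thesis
    using card_hyperplanes_superset[of "span (insert v p)"] d dimension_ge_3
    by (intro gaussian_eqI[OF CARD_ge_2]) simp
qed

lemma points_in_two_hyperplanes:
  assumes "h \<in> hyperplanes" "h' \<in> hyperplanes" "h \<noteq> h'"
  shows "card {p \<in> points. p \<subseteq> h \<and> p \<subseteq> h'} = gaussian CARD('a) (dimension - 2)"
proof (rule gaussian_eqI[OF CARD_ge_2])
  have "subspace (h \<inter> h')" using assms by (auto intro: subspace_inter)
  then show "(CARD('a) - 1) * card {p \<in> points. p \<subseteq> h \<and> p \<subseteq> h'} + 1 = CARD('a) ^ (dimension - 2)"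
    using card_points_subset[of "h \<inter> h'"] card_hyperplanes_Int[OF assms] dimension_ge_3 by simp
qed

lemma card_points: "card points = gaussian CARD('a) dimension"
  using card_points_subset[OF subspace_UNIV] card_space by (intro gaussian_eqI[OF CARD_ge_2]) simp

lemma card_hyperplanes: "card hyperplanes = gaussian CARD('a) dimension"
  using card_hyperplanes_superset[of "{0}"] dimension_ge_3
  by (intro gaussian_eqI[OF CARD_ge_2]) (simp add: subspace_0 cong: conj_cong)

sublocale symmetric_design points hyperplanes "(\<subseteq>)"
  "gaussian CARD('a) dimension" "gaussian CARD('a) (dimension - 1)" "gaussian CARD('a) (dimension - 2)"
proof
  show "card {h \<in> hyperplanes. p \<subseteq> h} = gaussian CARD('a) (dimension - 1)" if "p \<in> points" for p
    using that card_hyperplanes_superset[of p] dimension_ge_3 by (intro gaussian_eqI[OF CARD_ge_2]) simp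
  show "card {p \<in> points. p \<subseteq> h} = gaussian CARD('a) (dimension - 1)" if "h \<in> hyperplanes" for h
    using that card_points_subset[of h] card_subspace[of h] by (intro gaussian_eqI[OF CARD_ge_2]) simp
qed (fact finite_family card_points card_hyperplanes hyperplanes_above_two_points
      points_in_two_hyperplanes)+

end

section \<open>Distances and eigenvalues of the graph\<close>

text \<open>Covers the rows of both kinds: \<open>A\<close> is the class of \<open>u\<close>,
  \<open>B\<close> the other one, \<open>R\<close> incidence. Weight 2 on all of \<open>A\<close> is
  wrong only at \<open>u\<close>, and the weights on \<open>B\<close> are 3 lowered by 2 where
  \<open>R\<close> holds.\<close>

lemma sum_weights_0_2_1_3:
  fixes f :: "'v \<Rightarrow> complex"
  assumes fin: "finite A" "finite B" and disj: "A \<inter> B = {}" and u: "u \<in> A" "d u = 0"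
    and A: "\<And>w. w \<in> A \<Longrightarrow> u \<noteq> w \<Longrightarrow> d w = 2"
    and B: "\<And>w. w \<in> B \<Longrightarrow> R w \<Longrightarrow> d w = 1" "\<And>w. w \<in> B \<Longrightarrow> \<not> R w \<Longrightarrow> d w = 3"
  shows "(\<Sum>w\<in>A \<union> B. d w * f w)
    = 2 * (sum f A - f u) + (3 * sum f B - 2 * (\<Sum>w | w \<in> B \<and> R w. f w))"
proof -
  have "(\<Sum>w\<in>A. d w * f w) = (\<Sum>w\<in>A. 2 * f w - (if w = u then 2 * f w else 0))"
    using A u by (intro sum.cong) auto
  also have "\<dots> = 2 * (sum f A - f u)"
    using u fin by (simp add: sum_subtractf right_diff_distrib flip: sum_distrib_left)
  moreover have "(\<Sum>w\<in>B. d w * f w) = (\<Sum>w\<in>B. 3 * f w - (if R w then 2 * f w else 0))"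
    using B by (intro sum.cong) auto
  moreover have "\<dots> = 3 * sum f B - 2 * (\<Sum>w | w \<in> B \<and> R w. f w)"
    using fin by (simp add: sum_subtractf sum_distrib_left sum.inter_filter if_distrib[of "(*) 2"])
  ultimately show ?thesis
    using fin disj by (simp add: sum.union_disjoint)
qed

section \<open>Adjacency and distances between points and hyperplanes\<close>

context projective_space begin

lemma pverts_S_graph: "pverts S_graph = points \<union> hyperplanes"
  by (simp add: S_graph_def Let_def dimension_def)

lemma points_hyperplanes_disjoint: "points \<inter> hyperplanes = {}"
  using dimension_ge_3 by auto

lemma parcs_points: "p \<in> points \<Longrightarrow> p' \<in> points \<Longrightarrow> (p, p') \<notin> parcs S_graph"
  using subspace_dim_equal[of p p'] subspace_dim_equal[of p' p]
  by (auto simp: S_graph_def Let_def)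

lemma parcs_hyperplanes: "h \<in> hyperplanes \<Longrightarrow> h' \<in> hyperplanes \<Longrightarrow> (h, h') \<notin> parcs S_graph"
  using subspace_dim_equal[of h h'] subspace_dim_equal[of h' h]
  by (auto simp: S_graph_def Let_def)

lemma parcs_point_hyperplane:
  assumes "p \<in> points" "h \<in> hyperplanes"
  shows "(p, h) \<in> parcs S_graph \<longleftrightarrow> p \<subseteq> h" "(h, p) \<in> parcs S_graph \<longleftrightarrow> p \<subseteq> h"
proof -
  have "p \<noteq> h" "\<not> h \<subset> p"
    using assms dimension_ge_3 dim_subset[of h p] by auto
  then show "(p, h) \<in> parcs S_graph \<longleftrightarrow> p \<subseteq> h" "(h, p) \<in> parcs S_graph \<longleftrightarrow> p \<subseteq> h"
    using assms by (auto simp: S_graph_def Let_def dimension_def)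
qed

lemma parcs_S_graph_cases:
  assumes "(u, w) \<in> parcs S_graph"
  obtains "u \<in> points" "w \<in> hyperplanes" "u \<subseteq> w" | "u \<in> hyperplanes" "w \<in> points" "w \<subseteq> u"
proof -
  have "u \<in> pverts S_graph" "w \<in> pverts S_graph"
    using assms by (auto simp: S_graph_def Let_def)
  then show ?thesis
    using assms that parcs_points parcs_hyperplanes parcs_point_hyperplane
    unfolding pverts_S_graph by blast
qed

lemma gaussian_pos: "0 < m \<Longrightarrow> 0 < gaussian CARD('a) m"
  using gaussian[OF CARD_ge_2, of m] one_less_power[of "CARD('a)" m] CARD_ge_2
  by (cases "gaussian CARD('a) m") auto

text \<open>The count is positive because \<open>dimension - 2 > 0\<close>; for equal points the
  degree replaces the codegree.\<close>

lemma ex_hyperplane_above: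
  assumes "p \<in> points" "p' \<in> points"
  obtains h where "h \<in> hyperplanes" "p \<subseteq> h" "p' \<subseteq> h"
proof -
  have "0 < card {h \<in> hyperplanes. p \<subseteq> h \<and> p' \<subseteq> h}"
    using assms codegree_P[of p p'] degree_P[of p] gaussian_pos dimension_ge_3
    by (cases "p = p'") simp_all
  then show ?thesis using that by (fastforce simp: card_gt_0_iff)
qed

lemma ex_point_below:
  assumes "h \<in> hyperplanes" "h' \<in> hyperplanes"
  obtains p where "p \<in> points" "p \<subseteq> h" "p \<subseteq> h'"
proof -
  have "0 < card {p \<in> points. p \<subseteq> h \<and> p \<subseteq> h'}"
    using assms codegree_H[of h h'] degree_H[of h] gaussian_pos dimension_ge_3
    by (cases "h = h'") simp_all
  then show ?thesis using that by (fastforce simp: card_gt_0_iff)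
qed

interpretation G: wf_digraph "with_proj S_graph"
  by (rule S_graph_wf)

lemma graph_distance_self:
  assumes "u \<in> pverts S_graph"
  shows "graph_distance S_graph u u = ereal (real 0)"
  by (rule graph_distance_eqI[OF S_graph_wf, of _ "[]"]) (use assms in \<open>auto simp: G.awalk_simps\<close>)

lemma graph_distance_points:
  assumes "p \<in> points" "p' \<in> points" "p \<noteq> p'"
  shows "graph_distance S_graph p p' = ereal (real 2)"
proof -
  obtain h where h: "h \<in> hyperplanes" "p \<subseteq> h" "p' \<subseteq> h"
    using ex_hyperplane_above assms by blast
  show ?thesis
  proof (rule graph_distance_eqI[OF S_graph_wf])
    show "G.awalk p [(p, h), (h, p')] p'"
      using assms h by (simp add: G.awalk_simps parcs_point_hyperplane pverts_S_graph)
  qed (use assms parcs_points awalk_length_ge_2[OF _ _ _ S_graph_wf] in auto)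
qed

lemma graph_distance_hyperplanes:
  assumes "h \<in> hyperplanes" "h' \<in> hyperplanes" "h \<noteq> h'"
  shows "graph_distance S_graph h h' = ereal (real 2)"
proof -
  obtain p where p: "p \<in> points" "p \<subseteq> h" "p \<subseteq> h'"
    using ex_point_below assms by blast
  show ?thesis
  proof (rule graph_distance_eqI[OF S_graph_wf])
    show "G.awalk h [(h, p), (p, h')] h'"
      using assms p by (simp add: G.awalk_simps parcs_point_hyperplane pverts_S_graph)
  qed (use assms parcs_hyperplanes awalk_length_ge_2[OF _ _ _ S_graph_wf] in auto)
qed

lemma graph_distance_incident:
  assumes "p \<in> points" "h \<in> hyperplanes" "p \<subseteq> h"
  shows "graph_distance S_graph p h = ereal (real 1)" "graph_distance S_graph h p = ereal (real 1)"
proof -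
  have ne: "p \<noteq> h" using assms points_hyperplanes_disjoint by blast
  have len: "1 \<le> length w" if "G.awalk u w v" "u \<noteq> v" for u w v
    using that by (cases w) (auto simp: G.awalk_simps)
  show "graph_distance S_graph p h = ereal (real 1)"
  proof (rule graph_distance_eqI[OF S_graph_wf])
    show "G.awalk p [(p, h)] h"
      using assms by (simp add: G.awalk_simps parcs_point_hyperplane pverts_S_graph)
  qed (use ne len in auto)
  show "graph_distance S_graph h p = ereal (real 1)"
  proof (rule graph_distance_eqI[OF S_graph_wf])
    show "G.awalk h [(h, p)] p"
      using assms by (simp add: G.awalk_simps parcs_point_hyperplane pverts_S_graph)
  qed (use ne len in auto)
qed

text \<open>Arcs alternate between the classes, so a walk of two arcs ends in the class where it
  starts. Three arcs suffice: any point \<open>p'\<close> on \<open>h\<close> shares a hyperplane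
  \<open>h'\<close> with \<open>p\<close>.\<close>

lemma graph_distance_not_incident:
  assumes "p \<in> points" "h \<in> hyperplanes" "\<not> p \<subseteq> h"
  shows "graph_distance S_graph p h = ereal (real 3)" "graph_distance S_graph h p = ereal (real 3)"
proof -
  have ne: "p \<noteq> h" using assms by blast
  obtain p' where p': "p' \<in> points" "p' \<subseteq> h"
    using ex_point_below assms by blast
  obtain h' where h': "h' \<in> hyperplanes" "p \<subseteq> h'" "p' \<subseteq> h'"
    using ex_hyperplane_above assms p' by blast
  have no_path: "\<not> ((p, w) \<in> parcs S_graph \<and> (w, h) \<in> parcs S_graph)"
    "\<not> ((h, w) \<in> parcs S_graph \<and> (w, p) \<in> parcs S_graph)" for w
    using assms points_hyperplanes_disjoint by (blast elim: parcs_S_graph_cases)+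
  show "graph_distance S_graph p h = ereal (real 3)"
  proof (rule graph_distance_eqI[OF S_graph_wf])
    show "G.awalk p [(p, h'), (h', p'), (p', h)] h"
      using assms p' h' by (simp add: G.awalk_simps parcs_point_hyperplane pverts_S_graph)
    show "3 \<le> length w" if "G.awalk p w h" for w
      using assms(3) parcs_point_hyperplane[OF assms(1,2)] no_path
      by (intro awalk_length_ge_3[OF that ne _ _ S_graph_wf]) auto
  qed simp
  show "graph_distance S_graph h p = ereal (real 3)"
  proof (rule graph_distance_eqI[OF S_graph_wf])
    show "G.awalk h [(h, p'), (p', h'), (h', p)] p"
      using assms p' h' by (simp add: G.awalk_simps parcs_point_hyperplane pverts_S_graph)
    show "3 \<le> length w" if "G.awalk h w p" for w
      using assms(3) parcs_point_hyperplane[OF assms(1,2)] no_path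
      by (intro awalk_length_ge_3[OF that ne[symmetric] _ _ S_graph_wf]) auto
  qed simp
qed

lemma sum_distances_point:
  fixes f :: "'b set \<Rightarrow> complex"
  assumes "p \<in> points"
  shows "(\<Sum>w\<in>pverts S_graph. of_real (real_of_ereal (graph_distance S_graph p w)) * f w)
    = 2 * (sum f points - f p) + (3 * sum f hyperplanes - 2 * (\<Sum>h | h \<in> hyperplanes \<and> p \<subseteq> h. f h))"
  unfolding pverts_S_graph
  using assms graph_distance_points graph_distance_incident(1) graph_distance_not_incident(1)
    points_hyperplanes_disjoint
  by (intro sum_weights_0_2_1_3)
    (simp_all add: finite_family graph_distance_self pverts_S_graph)

lemma sum_distances_hyperplane:
  fixes f :: "'b set \<Rightarrow> complex"
  assumes "h \<in> hyperplanes"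
  shows "(\<Sum>w\<in>pverts S_graph. of_real (real_of_ereal (graph_distance S_graph h w)) * f w)
    = 2 * (sum f hyperplanes - f h) + (3 * sum f points - 2 * (\<Sum>p | p \<in> points \<and> p \<subseteq> h. f p))"
  \<comment> \<open>After the swap the class of \<open>h\<close> comes first, as
    \<open>sum_weights_0_2_1_3\<close> expects.\<close>
  unfolding pverts_S_graph Un_commute[of points]
  using assms graph_distance_hyperplanes graph_distance_incident(2) graph_distance_not_incident(2)
    points_hyperplanes_disjoint
  by (intro sum_weights_0_2_1_3)
    (simp_all add: finite_family Int_commute graph_distance_self pverts_S_graph)

section \<open>The spectrum of the graph\<close>

interpretation dual: symmetric_design hyperplanes points "\<lambda>h p. p \<subseteq> h"
  "gaussian CARD('a) dimension" "gaussian CARD('a) (dimension - 1)" "gaussian CARD('a) (dimension - 2)"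
  by (rule dual)

text \<open>As the classes are disjoint, a pair of functions on them glues to one function on the
  vertices; conversely a vertex function serves as both \<open>x\<close> and
  \<open>y\<close>.\<close>

lemma distance_eigenvalues_S_graph_iff:
  "\<mu> \<in> distance_eigenvalues S_graph \<longleftrightarrow>
    (\<exists>x y. ((\<exists>p\<in>points. x p \<noteq> 0) \<or> (\<exists>h\<in>hyperplanes. y h \<noteq> 0)) \<and>
      point_equation \<mu> x y \<and> dual.point_equation \<mu> y x)" (is "_ \<longleftrightarrow> ?R")
proof -
  have "\<mu> \<in> distance_eigenvalues S_graph \<longleftrightarrow>
    (\<exists>f. (\<exists>u\<in>points \<union> hyperplanes. f u \<noteq> 0) \<and> point_equation \<mu> f f \<and> dual.point_equation \<mu> f f)"
    unfolding distance_eigenvalues_iff[OF finite_family] point_equation_def dual.point_equation_def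
    \<comment> \<open>Only the bounds of quantifiers are rewritten to unions; the sums must keep
      \<open>pverts S_graph\<close> to match \<open>sum_distances_point\<close> and
      \<open>sum_distances_hyperplane\<close>.\<close>
    by (intro arg_cong[where f = Ex] ext)
      (simp add: sum_distances_point sum_distances_hyperplane ball_Un bex_Un
        pverts_S_graph[THEN arg_cong[where f = "\<lambda>A. Ball A _"]]
        pverts_S_graph[THEN arg_cong[where f = "\<lambda>A. Bex A _"]])
  also have "\<dots> \<longleftrightarrow> ?R"
  proof
    assume ?R
    then obtain x y where nz: "(\<exists>p\<in>points. x p \<noteq> 0) \<or> (\<exists>h\<in>hyperplanes. y h \<noteq> 0)"
      and eq: "point_equation \<mu> x y" "dual.point_equation \<mu> y x" by blast
    define f where "f u = (if u \<in> points then x u else y u)" for u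
    have fx: "f p = x p" if "p \<in> points" for p using that by (simp add: f_def)
    have fy: "f h = y h" if "h \<in> hyperplanes" for h
      using that points_hyperplanes_disjoint unfolding f_def by (simp only: disjoint_iff if_False) metis
    have sums: "sum f A = sum x A" if "A \<subseteq> points" for A using that fx by (intro sum.cong) auto
    have sums': "sum f A = sum y A" if "A \<subseteq> hyperplanes" for A using that fy by (intro sum.cong) auto
    have "point_equation \<mu> f f"
      using eq(1) unfolding point_equation_def by (simp add: fx sums sums' Collect_mono)
    moreover have "dual.point_equation \<mu> f f"
      using eq(2) unfolding dual.point_equation_def by (simp add: fy sums sums' Collect_mono)
    moreover have "\<exists>u\<in>points \<union> hyperplanes. f u \<noteq> 0"
      using nz fx fy by (metis UnCI)
    ultimately show "\<exists>f. (\<exists>u\<in>points \<union> hyperplanes. f u \<noteq> 0) \<and>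
      point_equation \<mu> f f \<and> dual.point_equation \<mu> f f" by blast
  qed blast
  finally show ?thesis .
qed

lemma distance_eigenvalues_S_graph:
  "distance_eigenvalues S_graph = complex_of_real `
    {5 * real (gaussian CARD('a) dimension) - 2 * real (gaussian CARD('a) (dimension - 1)) - 2,
     - real (gaussian CARD('a) dimension) + 2 * real (gaussian CARD('a) (dimension - 1)) - 2,
     -2 - 2 * sqrt (real CARD('a) ^ (dimension - 2)), -2 + 2 * sqrt (real CARD('a) ^ (dimension - 2))}"
proof -
  have k: "gaussian CARD('a) (dimension - 1)
    = gaussian CARD('a) (dimension - 2) + CARD('a) ^ (dimension - 2)"
  proof -
    have "dimension - 1 = Suc (dimension - 2)" using dimension_ge_3 by simp
    then show ?thesis by (simp add: gaussian_def)
  qed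
  have N: "gaussian CARD('a) dimension
    = gaussian CARD('a) (dimension - 1) + CARD('a) ^ (dimension - 1)"
  proof -
    have "dimension = Suc (dimension - 1)" using dimension_ge_3 by simp
    then show ?thesis by (metis gaussian_def sum.lessThan_Suc)
  qed
  \<comment> \<open>These powers are \<open>k - l\<close> and \<open>N - k\<close> of the design;
    their positivity yields the assumptions of \<open>distance_spectrum\<close>.\<close>
  have "0 < CARD('a) ^ (dimension - 2)" "0 < CARD('a) ^ (dimension - 1)"
    using CARD_ge_2 by simp_all
  then have "2 \<le> gaussian CARD('a) dimension"
    "gaussian CARD('a) (dimension - 2) < gaussian CARD('a) (dimension - 1)"
    using k N by linarith+
  from distance_spectrum[OF this] show ?thesis
    unfolding Set.set_eq_iff distance_eigenvalues_S_graph_iff using k by simp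
qed

end

section \<open>Closed forms of the eigenvalues and integrality\<close>

theorem theorem3p1:
  fixes scale :: "'a :: {field, finite} \<Rightarrow> 'v :: ab_group_add \<Rightarrow> 'v"
    and q n :: nat
  assumes "vector_space scale"
    and "CARD('a) = q"
    and "vector_space.dim scale (UNIV :: 'v set) = n"
    and "n \<ge> 3"
  shows "distance_eigenvalues (vector_space.S_graph scale) =
      complex_of_real `
        {(5 * real q ^ n - 2 * real q ^ (n - 1) - 2 * real q - 1) / (real q - 1),
         (- (real q ^ n) + 2 * real q ^ (n - 1) - 2 * real q + 1) / (real q - 1),
         (- 2 * (real q)\<^sup>2 - 2 * sqrt (real q ^ (n + 2))) / (real q)\<^sup>2,
         (- 2 * (real q)\<^sup>2 + 2 * sqrt (real q ^ (n + 2))) / (real q)\<^sup>2}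
    \<and> (even n \<longrightarrow> distance_integral (vector_space.S_graph scale))"
proof -
  interpret vector_space scale by fact
  obtain B where B: "independent B" "UNIV \<subseteq> span B" "card B = n"
    using basis_exists[of UNIV] assms(3) by metis
  \<comment> \<open>\<open>card\<close> is 0 on infinite sets, so \<open>card B = n\<close> with
    \<open>n \<ge> 3\<close> makes the basis finite.\<close>
  interpret finite_dimensional_vector_space scale B
    using B assms(4) by unfold_locales (auto intro: card_ge_0_finite)
  interpret projective_space scale B
    using B assms(4) by unfold_locales (simp add: dimension_def)
  have n: "dimension = n" using B by (simp add: dimension_def)
  have q: "q \<ge> 2" using CARD_ge_2 assms(2) by simp
  let ?g = "\<lambda>m. real (gaussian q m)"
  have eig: "distance_eigenvalues S_graph = complex_of_real `
    {5 * ?g n - 2 * ?g (n - 1) - 2, - ?g n + 2 * ?g (n - 1) - 2,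
     -2 - 2 * sqrt (real q ^ (n - 2)), -2 + 2 * sqrt (real q ^ (n - 2))}"
    using distance_eigenvalues_S_graph unfolding n assms(2) .
  \<comment> \<open>Relates \<open>?g\<close> to powers of \<open>q\<close>, so that the quotients
    can be checked after multiplication by \<open>q - 1\<close>.\<close>
  have g: "real q * ?g m = ?g m + real q ^ m - 1" for m
  proof -
    have "q * gaussian q m + 1 = gaussian q m + q ^ m"
      using gaussian[OF q, of m] q by (cases q) auto
    then have "real (q * gaussian q m + 1) = real (gaussian q m + q ^ m)" by (rule arg_cong)
    then show ?thesis by simp
  qed
  \<comment> \<open>Since \<open>n + 2 = (n - 2) + 4\<close>, a factor \<open>q ^ 4\<close> leaves
    the root as \<open>q ^ 2\<close>.\<close>
  have s: "sqrt (real q ^ (n + 2)) = (real q)\<^sup>2 * sqrt (real q ^ (n - 2))"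
  proof -
    have "n + 2 = (n - 2) + 2 * 2" using assms(4) by simp
    then have "real q ^ (n + 2) = real q ^ (n - 2) * ((real q)\<^sup>2)\<^sup>2"
      by (metis power_add power_mult)
    then show ?thesis by (simp only: real_sqrt_mult real_sqrt_abs abs_power2 mult.commute)
  qed
  have q0: "real q - 1 \<noteq> 0" "(real q)\<^sup>2 \<noteq> 0" using q by auto
  have "5 * ?g n - 2 * ?g (n - 1) - 2
      = (5 * real q ^ n - 2 * real q ^ (n - 1) - 2 * real q - 1) / (real q - 1)"
    "- ?g n + 2 * ?g (n - 1) - 2
      = (- (real q ^ n) + 2 * real q ^ (n - 1) - 2 * real q + 1) / (real q - 1)"
    unfolding nonzero_eq_divide_eq[OF q0(1)] using g[of n] g[of "n - 1"]
    by (simp_all add: algebra_simps)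
  moreover have
    "-2 - 2 * sqrt (real q ^ (n - 2)) = (- 2 * (real q)\<^sup>2 - 2 * sqrt (real q ^ (n + 2))) / (real q)\<^sup>2"
    "-2 + 2 * sqrt (real q ^ (n - 2)) = (- 2 * (real q)\<^sup>2 + 2 * sqrt (real q ^ (n + 2))) / (real q)\<^sup>2"
    unfolding nonzero_eq_divide_eq[OF q0(2)] s by (simp_all add: algebra_simps)
  moreover have "even n \<longrightarrow> distance_integral S_graph"
  proof
    assume "even n"
    \<comment> \<open>An even exponent makes the radicand the square of \<open>q ^ m\<close>; in
      \<open>eig\<close> the other two eigenvalues are already integer combinations of natural
      numbers.\<close>
    obtain m where "n - 2 = 2 * m" using \<open>even n\<close> by (metis dvdE dvd_diff_nat dvd_refl)
    then have "sqrt (real q ^ (n - 2)) = real (q ^ m)"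
      by (simp add: power_mult power_mult_distrib real_sqrt_power flip: power_even_eq)
    then show "distance_integral S_graph"
      unfolding distance_integral_def eig by auto
  qed
  ultimately show ?thesis using eig by (simp only: simp_thms)
qed

end
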